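(* Let $\mathbb{T}$ be the homogeneous tree of degree $q+1>2$ and let $u:\mathbb{T}\times\mathbb{Z}\to\mathbb{C}$ be a solution to $$\gamma\,\mathcal{L}^{\mathbb{Z}}_nu(x,n)=\bigl(\mathcal{L}^{\mathbb{T}}_x-1+\gamma\bigr)u(x,n),\qquad u(x,0)=f(x),\quad\tfrac{u(x,1)-u(x,-1)}2=g(x),$$ with finitely supported initial data $f,g:\mathbb{T}\to\mathbb{C}$. Let $(N_n)_{n\in\mathbb{Z}}$ be a sequence of positive integers such that $N_n\to+\infty$ and $N_n=o(|n|)$ as $n\to\pm\infty$. Then the expressions $$\sum_{\substack{x\in\mathbb{T}\\|x|<|n|-N_n}}|u(x,n)|^2,\qquad\sum_{\substack{x,y\in\mathbb{T}\\|x|,|y|<|n|-N_n\\d(x,y)=2}}|u(x,n)-u(y,n)|^2,\qquad\sum_{\substack{x\in\mathbb{T}\\|x|<|n|-N_n}}|u(x,n+1)-u(x,n-1)|^2$$ tend to $0$ as $n\to\pm\infty$. (In this sense, the energy of $u$ concentrates asymptotically inside the spherical shell $\{x\in\mathbb{T}:|n|-N_n\le|x|\le|n|+N_n\}$.)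
   Context: $\mathbb{T}=\mathbb{T}_q$ ($q\ge2$ an integer) is the homogeneous tree of degree $q+1$: the connected graph without loops in which every vertex has exactly $q+1$ neighbors. It is identified with its vertex set; $d$ is the graph distance, $S(x,n)=\{y\in\mathbb{T}:d(x,y)=n\}$, and $|x|$ is the distance of $x$ to a fixed origin $0\in\mathbb{T}$. The combinatorial Laplacians are $$\mathcal{L}^{\mathbb{Z}}f(n)=f(n)-\tfrac{f(n+1)+f(n-1)}2,\qquad\mathcal{L}^{\mathbb{T}}f(x)=f(x)-\tfrac1{q+1}\sum_{y\in S(x,1)}f(y),$$ subscripts indicating the variable in which they act, and $\gamma=\frac2{q^{1/2}+q^{-1/2}}\in(0,1)$. The energy of $u$ at time $n$ is $\mathcal{E}(n)=\mathcal{K}(n)+\mathcal{P}(n)$, where $\mathcal{K}(n)=\frac12\sum_{x}\bigl|\frac{u(x,n+1)-u(x,n-1)}2\bigr|^2$ and $\mathcal{P}(n)=\frac1{4q}\sum_{d(x,y)=2}\bigl|\frac{u(x,n)-u(y,n)}2\bigr|^2-\frac{(q-1)^2}{8q}\sum_x|u(x,n)|^2$ (first sum over ordered pairs $(x,y)$). *)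

theory Defs
  imports "HOL-Analysis.Analysis" "HOL-Library.Landau_Symbols"
begin

definition graph_cycle :: "('v \<Rightarrow> 'v \<Rightarrow> bool) \<Rightarrow> 'v list \<Rightarrow> bool" where
  "graph_cycle adj p \<longleftrightarrow>
     length p \<ge> 3 \<and> distinct p \<and> successively adj p \<and> adj (last p) (hd p)"

definition graph_dist :: "('v \<Rightarrow> 'v \<Rightarrow> bool) \<Rightarrow> 'v \<Rightarrow> 'v \<Rightarrow> nat" where
  "graph_dist adj x y = (LEAST n. (adj ^^ n) x y)"

definition graph_sphere :: "('v \<Rightarrow> 'v \<Rightarrow> bool) \<Rightarrow> 'v \<Rightarrow> nat \<Rightarrow> 'v set" where
  "graph_sphere adj x n = {y. graph_dist adj x y = n}"

text \<open>The tree is identified with its vertex set, here the whole type \<open>'v\<close>. As a cardinality,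
  \<open>q + 1 > 0\<close> also forces each neighbourhood to be finite.\<close>

locale homogeneous_tree =
  fixes adj :: "'v \<Rightarrow> 'v \<Rightarrow> bool" and q :: nat
  assumes adj_sym: "adj x y \<Longrightarrow> adj y x"
    and adj_irrefl: "\<not> adj x x"
    and connected: "adj\<^sup>*\<^sup>* x y"
    and no_cycle: "\<not> graph_cycle adj p"
    and degree: "card {y. adj x y} = q + 1"

definition laplacian_int :: "(int \<Rightarrow> complex) \<Rightarrow> int \<Rightarrow> complex" where
  "laplacian_int h n = h n - (h (n + 1) + h (n - 1)) / 2"

definition laplacian_tree ::
  "('v \<Rightarrow> 'v \<Rightarrow> bool) \<Rightarrow> nat \<Rightarrow> ('v \<Rightarrow> complex) \<Rightarrow> 'v \<Rightarrow> complex" where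
  "laplacian_tree adj q h x = h x - 1 / (of_nat q + 1) * (\<Sum>y\<in>graph_sphere adj x 1. h y)"

definition gamma_const :: "nat \<Rightarrow> real" where
  "gamma_const q = 2 / (real q powr (1/2) + real q powr (- 1/2))"

text \<open>A limit along this filter is a limit both as \<open>n \<rightarrow> +\<infinity>\<close> and as \<open>n \<rightarrow> -\<infinity>\<close>.\<close>

abbreviation at_pm_infinity :: "int filter" where
  "at_pm_infinity \<equiv> sup at_top at_bot"

context homogeneous_tree
begin

lemma finite_relpowp: "finite {y. (adj ^^ n) x y}"
proof (induction n)
  case 0
  then show ?case by simp
next
  case (Suc n)
  have "finite {y. adj z y}" for z
    using degree[of z] card.infinite by fastforce
  moreover have "{y. (adj ^^ Suc n) x y} = (\<Union>z\<in>{z. (adj ^^ n) x z}. {y. adj z y})"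
    by auto
  ultimately show ?case using Suc by simp
qed

lemma relpowp_graph_dist: "(adj ^^ graph_dist adj x y) x y"
  unfolding graph_dist_def using connected[of x y] by (metis LeastI rtranclp_imp_relpowp)

text \<open>Balls and spheres are finite, so finite sums over them do not degenerate to \<open>0\<close>.\<close>

lemma finite_sphere: "finite (graph_sphere adj x n)"
  by (rule finite_subset[OF _ finite_relpowp[of n x]])
     (auto simp: graph_sphere_def relpowp_graph_dist)

lemma finite_ball: "finite {x. int (graph_dist adj z x) < r}"
proof -
  have "{x. int (graph_dist adj z x) < r} \<subseteq> (\<Union>k<nat r. graph_sphere adj z k)"
    by (auto simp: graph_sphere_def)
  then show ?thesis by (rule finite_subset) (simp add: finite_sphere)
qed

lemma finite_ball_pairs:
  "finite {(x, y). int (graph_dist adj z x) < r \<and> int (graph_dist adj z y) < r \<and>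
                   graph_dist adj x y = 2}"
  by (rule finite_subset[OF _ finite_cartesian_product[OF finite_ball[of z r] finite_ball[of z r]]])
     auto

lemma graph_sphere_1: "graph_sphere adj x 1 = {y. adj x y}"
proof -
  have "graph_dist adj x y = 1 \<longleftrightarrow> adj x y" for y
  proof
    assume "graph_dist adj x y = 1"
    then show "adj x y" using relpowp_graph_dist[of x y] by (auto simp: OO_def)
  next
    assume "adj x y"
    then have "(adj ^^ 1) x y" by (auto simp: OO_def)
    then have "graph_dist adj x y \<le> 1" unfolding graph_dist_def by (rule Least_le)
    moreover have "graph_dist adj x y \<noteq> 0"
      using relpowp_graph_dist[of x y] \<open>adj x y\<close> adj_irrefl by (metis relpowp_0_E)
    ultimately show "graph_dist adj x y = 1" by simp
  qed
  then show ?thesis by (auto simp: graph_sphere_def)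
qed

end

end

theory Submission
  imports Defs
begin

text \<open>
  Write \<open>s = q\<^sup>-\<^sup>1\<^sup>/\<^sup>2\<close>. Since \<open>\<gamma> = 2 / (s + 1/s)\<close>, the wave equation is the recursion
  \<open>u(x,n+1) + u(x,n-1) = s \<Sum>\<^bsub>z ~ x\<^esub> u(z,n)\<close>, which is invariant under \<open>n \<mapsto> -n\<close>. On a tree its
  fundamental solution started at a vertex \<open>y\<close> (zero at time \<open>0\<close>, a unit mass at \<open>y\<close> at time
  \<open>1\<close>) is explicit: at time \<open>n \<ge> 1\<close> it is the constant \<open>s\<^sup>n\<^sup>-\<^sup>1\<close> on the vertices at distance
  \<open>k < n\<close> from \<open>y\<close> with \<open>n + k\<close> odd, and \<open>0\<close> elsewhere. The recursion for it only uses that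
  each \<open>x \<noteq> y\<close> has one neighbour closer to \<open>y\<close> and \<open>q\<close> neighbours farther away, which holds
  because there are no cycles.

  Finitely supported initial data therefore give the pointwise bound \<open>|u(x,n)| \<le> C q\<^sup>-\<^sup>|\<^sup>n\<^sup>|\<^sup>/\<^sup>2\<close>,
  uniformly in \<open>x\<close>. The ball \<open>|x| < |n| - N\<^sub>n\<close> has at most \<open>2 q ^ (|n| - N\<^sub>n)\<close> vertices, and each
  vertex has at most \<open>2 q\<^sup>2\<close> others at distance \<open>2\<close>, so that all three expressions are
  \<open>O(q ^ (- N\<^sub>n))\<close>.
\<close>

section \<open>Distances and neighbours in a homogeneous tree\<close>

text \<open>A walk can be shortened to a path without repeated vertices.\<close>

lemma rtranclp_imp_distinct_path:
  assumes "r\<^sup>*\<^sup>* a b"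
  shows "\<exists>p. p \<noteq> [] \<and> hd p = a \<and> last p = b \<and> distinct p \<and> successively r p"
  using assms
proof (induction rule: converse_rtranclp_induct)
  case base
  show ?case by (rule exI[of _ "[b]"]) simp
next
  case (step a c)
  then obtain p where p: "p \<noteq> []" "hd p = c" "last p = b" "distinct p" "successively r p"
    by blast
  show ?case
  proof (cases "a \<in> set p")
    case True
    then obtain xs ys where "p = xs @ a # ys" by (meson split_list)
    with p show ?thesis
      by (intro exI[of _ "a # ys"]) (auto simp: successively_append_iff)
  next
    case False
    with p step.hyps show ?thesis
      by (intro exI[of _ "a # p"]) (auto simp: successively_Cons)
  qed
qed

context homogeneous_tree
begin

abbreviation gdist :: "'v \<Rightarrow> 'v \<Rightarrow> nat" where
  "gdist \<equiv> graph_dist adj"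

lemma finite_neighbours: "finite {z. adj x z}"
  using degree[of x] card.infinite by fastforce

lemma gdist_le: "(adj ^^ n) y x \<Longrightarrow> gdist y x \<le> n"
  unfolding graph_dist_def by (rule Least_le)

lemma gdist_self [simp]: "gdist y y = 0"
  using gdist_le[of 0 y y] by simp

lemma gdist_eq_0_iff [simp]: "gdist y x = 0 \<longleftrightarrow> x = y"
  using relpowp_graph_dist[of y x] by (metis gdist_self relpowp_0_E)

lemma gdist_adj_le: "adj z x \<Longrightarrow> gdist y x \<le> Suc (gdist y z)"
  by (rule gdist_le) (use relpowp_graph_dist[of y z] in auto)

lemma gdist_SucE:
  assumes "gdist y x = Suc k"
  obtains z where "adj z x" "gdist y z = k"
proof -
  from relpowp_graph_dist[of y x] assms obtain z where z: "(adj ^^ k) y z" "adj z x"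
    by auto
  have "gdist y z \<le> k" using gdist_le z(1) by blast
  moreover have "Suc k \<le> Suc (gdist y z)" using gdist_adj_le[OF z(2), of y] assms by simp
  ultimately show thesis using that z(2) by simp
qed

text \<open>Two neighbours of \<open>x\<close> that can be joined outside \<open>x\<close> would close a cycle through \<open>x\<close>.\<close>

lemma neighbours_separated:
  assumes "adj x z" "adj x z'" "z \<noteq> z'"
  shows "\<not> (\<lambda>v w. adj v w \<and> v \<noteq> x \<and> w \<noteq> x)\<^sup>*\<^sup>* z z'"
proof
  let ?r = "\<lambda>v w. adj v w \<and> v \<noteq> x \<and> w \<noteq> x"
  assume "?r\<^sup>*\<^sup>* z z'"
  from rtranclp_imp_distinct_path[OF this] obtain p
    where p: "p \<noteq> []" "hd p = z" "last p = z'" "distinct p" "successively ?r p"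
    by blast
  from p(1,2,3) assms(3) obtain w ws where p_eq: "p = z # w # ws"
    by (cases p; cases "tl p") auto
  have "x \<notin> set vs" if "successively ?r (a # vs)" for a vs
    using that by (induction vs arbitrary: a) (auto simp: successively_Cons)
  from this[of z "w # ws"] have "x \<notin> set p"
    using p(5) by (auto simp: p_eq)
  moreover have "successively adj p"
    using p(5) by (rule successively_mono) auto
  ultimately have "graph_cycle adj (x # p)"
    using p assms adj_sym[OF assms(2)] unfolding graph_cycle_def p_eq by auto
  with no_cycle show False by blast
qed

text \<open>A geodesic to \<open>y\<close> from a vertex other than \<open>x\<close> that is not farther from \<open>y\<close> than \<open>x\<close>
  does not meet \<open>x\<close>.\<close>

lemma connected_avoiding:
  assumes "gdist y w \<le> gdist y x" "w \<noteq> x"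
  shows "(\<lambda>v w. adj v w \<and> v \<noteq> x \<and> w \<noteq> x)\<^sup>*\<^sup>* y w"
  using assms
proof (induction "gdist y w" arbitrary: w)
  case 0
  then show ?case by simp
next
  case (Suc k)
  then obtain z where z: "adj z w" "gdist y z = k" by (metis gdist_SucE)
  with Suc.hyps(2) Suc.prems have "z \<noteq> x" by auto
  with Suc z have "(\<lambda>v w. adj v w \<and> v \<noteq> x \<and> w \<noteq> x)\<^sup>*\<^sup>* y z" by simp
  then show ?case
    by (rule rtranclp.rtrancl_into_rtrancl) (use z Suc.prems \<open>z \<noteq> x\<close> in simp)
qed

lemma unique_neighbour_not_farther:
  assumes "adj x z" "adj x z'" "gdist y z \<le> gdist y x" "gdist y z' \<le> gdist y x"
  shows "z = z'"
proof (rule ccontr)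
  let ?r = "\<lambda>v w. adj v w \<and> v \<noteq> x \<and> w \<noteq> x"
  assume ne: "z \<noteq> z'"
  have nx: "z \<noteq> x" "z' \<noteq> x" using assms(1,2) adj_irrefl by auto
  have "symp ?r" by (rule sympI) (blast intro: adj_sym)
  then have "symp ?r\<^sup>*\<^sup>*" by (rule symp_rtranclp)
  with connected_avoiding[OF assms(3) nx(1)] have "?r\<^sup>*\<^sup>* z y" by (auto dest: sympD)
  with connected_avoiding[OF assms(4) nx(2)] have "?r\<^sup>*\<^sup>* z z'" by (rule rtranclp_trans[rotated])
  with neighbours_separated[OF assms(1,2) ne] show False by blast
qed

lemma neighbour_distances:
  assumes "x \<noteq> y"
  obtains p where "adj x p" "Suc (gdist y p) = gdist y x"
    "\<And>z. adj x z \<Longrightarrow> z \<noteq> p \<Longrightarrow> gdist y z = Suc (gdist y x)"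
proof -
  from assms have "gdist y x \<noteq> 0" by simp
  then obtain k where k: "gdist y x = Suc k" using not0_implies_Suc by blast
  from gdist_SucE[OF this] obtain p where p: "adj p x" "gdist y p = k" by metis
  have "gdist y z = Suc (gdist y x)" if z: "adj x z" "z \<noteq> p" for z
  proof (rule antisym[OF gdist_adj_le[OF z(1)]])
    show "Suc (gdist y x) \<le> gdist y z"
      using unique_neighbour_not_farther[OF z(1) adj_sym[OF p(1)], of y] z(2) k p(2)
      by fastforce
  qed
  with p(2) k show thesis using that[OF adj_sym[OF p(1)]] by simp
qed

text \<open>A sum over neighbours of a function of the distance to \<open>y\<close>, away from \<open>y\<close> and at \<open>y\<close>.\<close>

lemma sum_neighbours_radial:
  fixes F :: "nat \<Rightarrow> real"
  assumes "x \<noteq> y"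
  shows "(\<Sum>z\<in>{z. adj x z}. F (gdist y z))
           = F (gdist y x - 1) + real q * F (Suc (gdist y x))"
proof -
  obtain p where p: "adj x p" "Suc (gdist y p) = gdist y x"
    "\<And>z. adj x z \<Longrightarrow> z \<noteq> p \<Longrightarrow> gdist y z = Suc (gdist y x)"
    using neighbour_distances[OF assms] by blast
  have "(\<Sum>z\<in>{z. adj x z}. F (gdist y z))
          = F (gdist y p) + (\<Sum>z\<in>{z. adj x z} - {p}. F (gdist y z))"
    using p(1) by (intro sum.remove finite_neighbours) simp
  also have "(\<Sum>z\<in>{z. adj x z} - {p}. F (gdist y z))
               = (\<Sum>z\<in>{z. adj x z} - {p}. F (Suc (gdist y x)))"
    using p(3) by (intro sum.cong) auto
  also have "\<dots> = real q * F (Suc (gdist y x))"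
    using p(1) degree[of x] by simp
  also have "gdist y p = gdist y x - 1" using p(2) by simp
  finally show ?thesis .
qed

lemma sum_neighbours_radial_self:
  fixes F :: "nat \<Rightarrow> real"
  shows "(\<Sum>z\<in>{z. adj y z}. F (gdist y z)) = (real q + 1) * F 1"
proof -
  have "gdist y z = 1" if "adj y z" for z
    using graph_sphere_1[of y] that unfolding graph_sphere_def by blast
  then have "(\<Sum>z\<in>{z. adj y z}. F (gdist y z)) = (\<Sum>z\<in>{z. adj y z}. F 1)"
    by (intro sum.cong) auto
  then show ?thesis using degree[of y] by simp
qed

section \<open>The size of spheres and balls\<close>

lemma card_sphere_le:
  assumes "q \<ge> 1"
  shows "card (graph_sphere adj y k) \<le> 2 * q ^ k"
proof (induction k)
  case 0
  have "graph_sphere adj y 0 = {y}" by (auto simp: graph_sphere_def)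
  then show ?case by simp
next
  case (Suc k)
  show ?case
  proof (cases "k = 0")
    case True
    then show ?thesis using degree[of y] graph_sphere_1[of y] assms by simp
  next
    case False
    let ?C = "\<lambda>z. {x. adj z x \<and> gdist y x = Suc k}"
    have "card (?C z) \<le> q" if z: "z \<in> graph_sphere adj y k" for z
    proof -
      from z have dz: "gdist y z = k" by (simp add: graph_sphere_def)
      with False have "z \<noteq> y" by auto
      then obtain p where p: "adj z p" "Suc (gdist y p) = gdist y z"
        using neighbour_distances by metis
      then have "?C z \<subseteq> {x. adj z x} - {p}" using dz by auto
      then have "card (?C z) \<le> card ({x. adj z x} - {p})"
        using finite_neighbours by (intro card_mono) auto
      also have "\<dots> = q" using p(1) degree[of z] by simp
      finally show ?thesis .
    qed
    then have *: "(\<Sum>z\<in>graph_sphere adj y k. card (?C z)) \<le> card (graph_sphere adj y k) * q"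
      using sum_bounded_above[of "graph_sphere adj y k" "\<lambda>z. card (?C z)" q] by simp
    have "graph_sphere adj y (Suc k) = (\<Union>z\<in>graph_sphere adj y k. ?C z)"
      by (auto simp: graph_sphere_def elim: gdist_SucE)
    then have "card (graph_sphere adj y (Suc k)) \<le> (\<Sum>z\<in>graph_sphere adj y k. card (?C z))"
      using card_UN_le[OF finite_sphere] by simp
    also have "\<dots> \<le> card (graph_sphere adj y k) * q" by (rule *)
    also have "\<dots> \<le> 2 * q ^ k * q" using Suc.IH by (rule mult_right_mono) simp
    finally show ?thesis by (simp add: mult_ac)
  qed
qed

lemma card_ball_le:
  assumes "q \<ge> 2"
  shows "card {x. gdist y x < m} \<le> 2 * q ^ m"
proof -
  have "{x. gdist y x < m} = (\<Union>k<m. graph_sphere adj y k)"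
    by (auto simp: graph_sphere_def)
  then have "card {x. gdist y x < m} \<le> (\<Sum>k<m. card (graph_sphere adj y k))"
    using card_UN_le[of "{..<m}"] by simp
  also have "\<dots> \<le> (\<Sum>k<m. 2 * q ^ k)"
    using assms by (intro sum_mono card_sphere_le) simp
  also have "\<dots> \<le> 2 * q ^ m"
  proof (induction m)
    case (Suc m)
    then have "(\<Sum>k<Suc m. 2 * q ^ k) \<le> 2 * (2 * q ^ m)" by simp
    also have "\<dots> \<le> 2 * (q * q ^ m)" using assms by (intro mult_left_mono mult_right_mono) auto
    finally show ?case by simp
  qed simp
  finally show ?thesis .
qed

section \<open>The fundamental solution and the pointwise decay\<close>

text \<open>The fundamental solution at time \<open>n\<close>, as a function of the distance \<open>k\<close> to its source.
  The value at \<open>n = 0\<close> is \<open>0\<close>, so the truncated exponent there is harmless.\<close>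

definition wave_kernel :: "nat \<Rightarrow> nat \<Rightarrow> real" where
  "wave_kernel n k = (if k < n \<and> odd (n + k) then (1 / sqrt (real q)) ^ (n - 1) else 0)"

lemma wave_kernel_0: "wave_kernel 0 k = 0"
  by (simp add: wave_kernel_def)

lemma wave_kernel_1: "wave_kernel 1 k = (if k = 0 then 1 else 0)"
  by (simp add: wave_kernel_def)

lemma abs_wave_kernel_Suc_le: "\<bar>wave_kernel (Suc n) k\<bar> \<le> (1 / sqrt (real q)) ^ n"
  by (simp add: wave_kernel_def)

lemma wave_kernel_rec:
  assumes "q \<ge> 1"
  shows "wave_kernel (n + 2) (gdist y x) + wave_kernel n (gdist y x)
           = 1 / sqrt (real q) * (\<Sum>z\<in>{z. adj x z}. wave_kernel (n + 1) (gdist y z))"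
proof -
  define s where "s = 1 / sqrt (real q)"
  have s2: "real q * (s * s) = 1" using assms by (simp add: s_def)
  have pw: "s ^ Suc n + s ^ (n - 1) = s * ((real q + 1) * s ^ n)" if n: "n \<ge> 1"
  proof -
    obtain m where "n = Suc m" using n by (cases n) auto
    moreover have "s * ((real q + 1) * s ^ Suc m) = real q * (s * s) * s ^ m + s ^ Suc (Suc m)"
      by (simp add: algebra_simps)
    ultimately show ?thesis using s2 by simp
  qed
  show ?thesis
  proof (cases "x = y")
    case True
    have *: "(\<Sum>z\<in>{z. adj x z}. wave_kernel (n + 1) (gdist y z))
               = (real q + 1) * wave_kernel (n + 1) 1"
      unfolding True by (rule sum_neighbours_radial_self)
    have "wave_kernel (n + 2) 0 + wave_kernel n 0 = s * ((real q + 1) * wave_kernel (n + 1) 1)"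
    proof (cases "odd n")
      case odd: True
      then have "n \<ge> 1" by (cases n) auto
      then show ?thesis using odd pw by (simp add: wave_kernel_def flip: s_def)
    qed (simp add: wave_kernel_def)
    then show ?thesis unfolding * s_def[symmetric] using True by simp
  next
    case False
    define k where "k = gdist y x"
    have "k \<noteq> 0" using False by (simp only: k_def gdist_eq_0_iff not_False_eq_True)
    then have k: "k \<ge> 1" by linarith
    have sum: "(\<Sum>z\<in>{z. adj x z}. wave_kernel (n + 1) (gdist y z))
            = wave_kernel (n + 1) (k - 1) + real q * wave_kernel (n + 1) (Suc k)"
      using sum_neighbours_radial[OF False] by (simp add: k_def)
    \<comment> \<open>Both sides vanish in cases 1 and 4; in case 3, \<open>x\<close> lies on the front of the wave.\<close>
    have "k < n \<or> k = n \<or> k = Suc n \<or> k > Suc n" by linarith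
    moreover have "k = n \<Longrightarrow> even (n + k)" by simp
    ultimately consider "even (n + k)" | "odd (n + k)" "k < n" | "odd (n + k)" "k = Suc n"
      | "odd (n + k)" "k > Suc n"
      by blast
    then have "wave_kernel (n + 2) k + wave_kernel n k
                 = s * (wave_kernel (n + 1) (k - 1) + real q * wave_kernel (n + 1) (Suc k))"
    proof cases
      case 1
      then have "odd (n + 1 + (k - 1)) \<longleftrightarrow> False" using k by simp
      with 1 show ?thesis by (simp add: wave_kernel_def)
    next
      case 2
      then have "n \<ge> 1" by simp
      moreover have "odd (n + 1 + (k - 1))" "k - 1 < n + 1" using 2 k by simp_all
      ultimately show ?thesis using 2 pw
        by (simp add: wave_kernel_def distrib_right flip: s_def)
    next
      case 3
      then show ?thesis by (simp add: wave_kernel_def flip: s_def)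
    next
      case 4
      then show ?thesis by (simp add: wave_kernel_def)
    qed
    then show ?thesis unfolding sum s_def[symmetric] k_def[symmetric] .
  qed
qed

text \<open>The solution with data \<open>v\<^sub>0\<close>, \<open>v\<^sub>1\<close> is a superposition of fundamental solutions. The
  formula starts at time \<open>1\<close>.\<close>

lemma wave_representation:
  fixes v :: "nat \<Rightarrow> 'v \<Rightarrow> complex"
  assumes q: "q \<ge> 1"
    and rec: "\<And>n x. v (n + 2) x + v n x
                = of_real (1 / sqrt (real q)) * (\<Sum>z\<in>{z. adj x z}. v (n + 1) z)"
    and A: "finite A" "\<And>x. x \<notin> A \<Longrightarrow> v 0 x = 0" "\<And>x. x \<notin> A \<Longrightarrow> v 1 x = 0"
  shows "v (Suc n) x = (\<Sum>y\<in>A. of_real (wave_kernel (Suc n) (gdist y x)) * v 1 y)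
                     - (\<Sum>y\<in>A. of_real (wave_kernel n (gdist y x)) * v 0 y)"
proof -
  define c :: complex where "c = of_real (1 / sqrt (real q))"
  define G where "G j n x = (\<Sum>y\<in>A. of_real (wave_kernel n (gdist y x)) * v j y)" for j n x
  have G0: "G j 0 x = 0" for j x by (simp add: G_def wave_kernel_0)
  have G1: "G j 1 x = v j x" if "\<And>x. x \<notin> A \<Longrightarrow> v j x = 0" for j x
  proof -
    have "G j 1 x = (\<Sum>y\<in>A. if x = y then v j y else 0)"
      unfolding G_def wave_kernel_1 by (intro sum.cong) auto
    then show ?thesis using A(1) that by simp
  qed
  have Grec: "G j (n + 2) x + G j n x = c * (\<Sum>z\<in>{z. adj x z}. G j (n + 1) z)" for j n x
  proof -
    have "G j (n + 2) x + G j n x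
        = (\<Sum>y\<in>A. of_real (wave_kernel (n + 2) (gdist y x) + wave_kernel n (gdist y x)) * v j y)"
      by (simp add: G_def sum.distrib distrib_right)
    also have "\<dots> = (\<Sum>y\<in>A. \<Sum>z\<in>{z. adj x z}. c * (of_real (wave_kernel (n + 1) (gdist y z)) * v j y))"
      unfolding wave_kernel_rec[OF q] by (simp add: c_def sum_distrib_left sum_distrib_right mult.assoc)
    also have "\<dots> = (\<Sum>z\<in>{z. adj x z}. \<Sum>y\<in>A. c * (of_real (wave_kernel (n + 1) (gdist y z)) * v j y))"
      by (rule sum.swap)
    finally show ?thesis by (simp add: G_def sum_distrib_left)
  qed
  have "v (Suc n) x = G 1 (Suc n) x - G 0 n x"
  proof (induction n arbitrary: x rule: less_induct)
    case (less n)
    consider "n = 0" | "n = 1" | m where "n = m + 2" by (metis One_nat_def add_2_eq_Suc' not0_implies_Suc)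
    then show ?case
    proof cases
      case 1
      then show ?thesis using G1[OF A(3)] G0 by simp
    next
      case 2
      \<comment> \<open>The recursion reaches back to time \<open>0\<close>, which the formula does not cover.\<close>
      have IH: "v 1 z = G 1 1 z" for z using G1[OF A(3)] by simp
      have "v 2 x = c * (\<Sum>z\<in>{z. adj x z}. G 1 1 z) - v 0 x"
        using rec[of 0 x] IH by (simp add: c_def algebra_simps numeral_2_eq_2)
      also have "\<dots> = G 1 2 x - G 0 1 x"
        using Grec[of 1 0 x] G0 G1[OF A(2)] by (simp add: numeral_2_eq_2)
      finally show ?thesis using 2 by (simp add: numeral_2_eq_2)
    next
      case 3
      have IH: "v (m + 2) z = G 1 (m + 2) z - G 0 (m + 1) z"
               "v (m + 1) z = G 1 (m + 1) z - G 0 m z" for z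
        using less[of "m + 1" z] less[of m z] 3 by auto
      have "v (m + 3) x = c * (\<Sum>z\<in>{z. adj x z}. v (m + 2) z) - v (m + 1) x"
        using rec[of "m + 1" x] by (simp add: c_def algebra_simps numeral_eq_Suc)
      also have "\<dots> = c * (\<Sum>z\<in>{z. adj x z}. G 1 (m + 2) z) - G 1 (m + 1) x
                     - (c * (\<Sum>z\<in>{z. adj x z}. G 0 (m + 1) z) - G 0 m x)"
        unfolding IH by (simp add: sum_subtractf algebra_simps)
      also have "c * (\<Sum>z\<in>{z. adj x z}. G 1 (m + 2) z) = G 1 (m + 3) x + G 1 (m + 1) x"
        using Grec[of 1 "m + 1" x] by (simp add: numeral_eq_Suc)
      also have "c * (\<Sum>z\<in>{z. adj x z}. G 0 (m + 1) z) = G 0 (m + 2) x + G 0 m x"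
        using Grec[of 0 m x] by simp
      also have "G 1 (m + 3) x + G 1 (m + 1) x - G 1 (m + 1) x - (G 0 (m + 2) x + G 0 m x - G 0 m x)
                   = G 1 (m + 3) x - G 0 (m + 2) x"
        by simp
      finally show ?thesis using 3 by (simp add: numeral_eq_Suc)
    qed
  qed
  then show ?thesis by (simp add: G_def)
qed

lemma wave_decay:
  fixes v :: "nat \<Rightarrow> 'v \<Rightarrow> complex"
  assumes q: "q \<ge> 1"
    and rec: "\<And>n x. v (n + 2) x + v n x
                = of_real (1 / sqrt (real q)) * (\<Sum>z\<in>{z. adj x z}. v (n + 1) z)"
    and fin: "finite {x. v 0 x \<noteq> 0}" "finite {x. v 1 x \<noteq> 0}"
  obtains C where "\<And>n x. cmod (v n x) \<le> C * (1 / sqrt (real q)) ^ n"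
proof -
  define s where "s = 1 / sqrt (real q)"
  have s: "s > 0" using q by (simp add: s_def)
  define A where "A = {x. v 0 x \<noteq> 0} \<union> {x. v 1 x \<noteq> 0}"
  define M where "M j = (\<Sum>y\<in>A. cmod (v j y))" for j
  have M0: "M j \<ge> 0" for j by (simp add: M_def sum_nonneg)
  have A: "finite A" "\<And>x. x \<notin> A \<Longrightarrow> v 0 x = 0" "\<And>x. x \<notin> A \<Longrightarrow> v 1 x = 0"
    using fin by (auto simp: A_def)
  have G: "cmod (\<Sum>y\<in>A. of_real (wave_kernel (Suc n) (gdist y x)) * v j y) \<le> s ^ n * M j"
    for n x j
    unfolding M_def sum_distrib_left s_def
    by (intro sum_norm_le) (simp add: norm_mult mult_right_mono abs_wave_kernel_Suc_le)
  define C where "C = M 0 + M 1 / s + M 0 / (s * s)"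
  have "cmod (v n x) \<le> C * s ^ n" for n x
  proof (cases n)
    case 0
    have "cmod (v 0 x) \<le> M 0"
    proof (cases "x \<in> A")
      case True
      then show ?thesis unfolding M_def using A(1) by (intro member_le_sum) auto
    qed (use A(2) M0 in auto)
    also have "\<dots> \<le> C" using M0 s by (simp add: C_def)
    finally show ?thesis using 0 by simp
  next
    case (Suc m)
    have K: "cmod (\<Sum>y\<in>A. of_real (wave_kernel m (gdist y x)) * v 0 y) \<le> s ^ m / s * M 0"
    proof (cases m)
      case 0
      then show ?thesis using M0 s by (simp add: wave_kernel_0)
    next
      case (Suc l)
      then show ?thesis using G[where n = l and x = x and j = 0] s by simp
    qed
    have rep: "v n x = (\<Sum>y\<in>A. of_real (wave_kernel (Suc m) (gdist y x)) * v 1 y)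
                     - (\<Sum>y\<in>A. of_real (wave_kernel m (gdist y x)) * v 0 y)"
      unfolding Suc by (rule wave_representation[OF q rec A])
    have "cmod (v n x) \<le> s ^ m * M 1 + s ^ m / s * M 0"
      unfolding rep
      by (rule order_trans[OF norm_triangle_ineq4 add_mono[OF G K]])
    also have "\<dots> = (M 1 / s + M 0 / (s * s)) * s ^ n"
      using s by (simp add: Suc field_simps)
    also have "\<dots> \<le> C * s ^ n"
      using s M0 by (intro mult_right_mono) (auto simp: C_def)
    finally show ?thesis .
  qed
  then show thesis using that unfolding s_def by blast
qed

text \<open>Reversing time preserves the recursion, so both time directions follow from the previous
  lemma. The recursion at time \<open>0\<close> makes the sum of the data at times \<open>1\<close> and \<open>-1\<close> finitely
  supported, and their difference is so by assumption; hence both are.\<close>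

lemma two_sided_wave_decay:
  fixes u :: "'v \<Rightarrow> int \<Rightarrow> complex"
  assumes q: "q \<ge> 1"
    and rec: "\<And>n x. u x (n + 1) + u x (n - 1)
                = of_real (1 / sqrt (real q)) * (\<Sum>z\<in>{z. adj x z}. u z n)"
    and fin: "finite {x. u x 0 \<noteq> 0}" "finite {x. u x 1 \<noteq> u x (- 1)}"
  obtains C where "C \<ge> 0" "\<And>n x. cmod (u x n) \<le> C * (1 / sqrt (real q)) ^ nat \<bar>n\<bar>"
proof -
  define T where "T = {x. u x 1 \<noteq> u x (- 1)} \<union> (\<Union>z\<in>{x. u x 0 \<noteq> 0}. {x. adj z x})"
  have T: "finite T" using fin finite_neighbours by (simp add: T_def)
  have zero: "u x 1 = 0" "u x (- 1) = 0" if "x \<notin> T" for x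
  proof -
    have "\<forall>z\<in>{z. adj x z}. u z 0 = 0"
      using that unfolding T_def by (blast intro: adj_sym)
    then have "(\<Sum>z\<in>{z. adj x z}. u z 0) = 0" by (rule sum.neutral)
    then have "u x 1 + u x (- 1) = 0" using rec[of x 0] by simp
    moreover have "u x 1 = u x (- 1)" using that by (simp add: T_def)
    ultimately show "u x 1 = 0" "u x (- 1) = 0" by auto
  qed
  have fin1: "finite {x. u x 1 \<noteq> 0}" "finite {x. u x (- 1) \<noteq> 0}"
    using zero by (auto intro: finite_subset[OF _ T])
  obtain C1 where C1: "\<And>n x. cmod (u x (int n)) \<le> C1 * (1 / sqrt (real q)) ^ n"
  proof (rule wave_decay[OF q, of "\<lambda>n x. u x (int n)"])
    show "u x (int (n + 2)) + u x (int n)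
            = of_real (1 / sqrt (real q)) * (\<Sum>z\<in>{z. adj x z}. u z (int (n + 1)))" for n x
      using rec[of x "int n + 1"] by (simp add: add.commute)
  qed (use fin fin1 in auto)
  obtain C2 where C2: "\<And>n x. cmod (u x (- int n)) \<le> C2 * (1 / sqrt (real q)) ^ n"
  proof (rule wave_decay[OF q, of "\<lambda>n x. u x (- int n)"])
    show "u x (- int (n + 2)) + u x (- int n)
            = of_real (1 / sqrt (real q)) * (\<Sum>z\<in>{z. adj x z}. u z (- int (n + 1)))" for n x
      using rec[of x "- int (n + 1)"] by (simp add: algebra_simps)
  qed (use fin fin1 in auto)
  define C where "C = max 0 (max C1 C2)"
  have "cmod (u x n) \<le> C * (1 / sqrt (real q)) ^ nat \<bar>n\<bar>" for n x
  proof -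
    have "cmod (u x n) \<le> max C1 C2 * (1 / sqrt (real q)) ^ nat \<bar>n\<bar>"
    proof (cases "n \<ge> 0")
      case True
      then have "cmod (u x n) \<le> C1 * (1 / sqrt (real q)) ^ nat \<bar>n\<bar>"
        using C1[of x "nat n"] by simp
      also have "\<dots> \<le> max C1 C2 * (1 / sqrt (real q)) ^ nat \<bar>n\<bar>"
        by (intro mult_right_mono) auto
      finally show ?thesis .
    next
      case False
      then have "cmod (u x n) \<le> C2 * (1 / sqrt (real q)) ^ nat \<bar>n\<bar>"
        using C2[of x "nat (- n)"] by simp
      also have "\<dots> \<le> max C1 C2 * (1 / sqrt (real q)) ^ nat \<bar>n\<bar>"
        by (intro mult_right_mono) auto
      finally show ?thesis .
    qed
    also have "\<dots> \<le> C * (1 / sqrt (real q)) ^ nat \<bar>n\<bar>"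
      by (intro mult_right_mono) (auto simp: C_def)
    finally show ?thesis .
  qed
  moreover have "C \<ge> 0" by (simp add: C_def)
  ultimately show thesis using that by blast
qed

lemma wave_equation_imp_recursion:
  assumes q: "q \<ge> 1"
    and wave: "of_real (gamma_const q) * laplacian_int (\<lambda>m. u x m) n =
                 laplacian_tree adj q (\<lambda>y. u y n) x - u x n + of_real (gamma_const q) * u x n"
  shows "u x (n + 1) + u x (n - 1)
           = of_real (1 / sqrt (real q)) * (\<Sum>z\<in>{z. adj x z}. u z n)"
proof -
  define r :: complex where "r = of_real (sqrt (real q))"
  define S where "S = (\<Sum>z\<in>{z. adj x z}. u z n)"
  have r: "r * r = of_nat q" "r \<noteq> 0"
    using q unfolding r_def by (simp_all flip: of_real_mult)
  define Q :: complex where "Q = of_nat q + 1"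
  have Q: "Q \<noteq> 0"
    unfolding Q_def by (metis of_nat_Suc of_nat_eq_0_iff add.commute nat.distinct(2))
  have "gamma_const q = 2 * sqrt (real q) / (real q + 1)"
    using q by (simp add: gamma_const_def powr_minus powr_half_sqrt field_simps)
  then have gam: "of_real (gamma_const q) = 2 * r / Q"
    by (simp add: r_def Q_def)
  have "of_real (gamma_const q) * (u x (n + 1) + u x (n - 1)) / 2 = S / Q"
    using wave by (simp add: laplacian_int_def laplacian_tree_def graph_sphere_1[simplified] S_def Q_def
        algebra_simps diff_divide_distrib add_divide_distrib)
  then have "r * (u x (n + 1) + u x (n - 1)) = S"
    unfolding gam using Q by simp
  then show ?thesis
    using r(2) unfolding S_def[symmetric] of_real_divide r_def[symmetric] by (simp add: field_simps)
qed

section \<open>Sums over the inner ball\<close>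

lemma sum_inner_ball_tendsto_0:
  fixes F :: "int \<Rightarrow> 'v \<Rightarrow> real" and N :: "int \<Rightarrow> nat"
  assumes q: "q \<ge> 2"
    and N: "filterlim N at_top L"
    and nonneg: "\<And>n x. F n x \<ge> 0"
    and le: "\<And>n x. F n x \<le> D * (1 / real q) ^ nat \<bar>n\<bar>"
  shows "((\<lambda>n. \<Sum>x\<in>{x. int (gdist org x) < \<bar>n\<bar> - int (N n)}. F n x) \<longlongrightarrow> 0) L"
proof (rule tendsto_sandwich)
  have "0 \<le> F 0 org" "F 0 org \<le> D" using nonneg le[of 0 org] by auto
  then have D: "D \<ge> 0" by linarith
  let ?B = "\<lambda>n. {x. int (gdist org x) < \<bar>n\<bar> - int (N n)}"
  show "\<forall>\<^sub>F n in L. 0 \<le> (\<Sum>x\<in>?B n. F n x)"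
    by (simp add: sum_nonneg nonneg)
  have "(\<Sum>x\<in>?B n. F n x) \<le> 2 * D * (1 / real q) ^ N n" for n
  proof (cases "\<bar>n\<bar> < int (N n)")
    case True
    then have "?B n = {}" by auto
    then show ?thesis using D by simp
  next
    case False
    define m where "m = nat \<bar>n\<bar> - N n"
    have n: "nat \<bar>n\<bar> = N n + m" using False by (simp add: m_def)
    have B: "?B n = {x. gdist org x < m}" using False by (auto simp: m_def)
    have "(\<Sum>x\<in>?B n. F n x) \<le> real (card (?B n)) * (D * (1 / real q) ^ nat \<bar>n\<bar>)"
      by (rule sum_bounded_above) (rule le)
    also have "\<dots> \<le> real (2 * q ^ m) * (D * (1 / real q) ^ nat \<bar>n\<bar>)"
      unfolding B using card_ball_le[OF q, of org m] D
      by (intro mult_right_mono) (simp_all only: of_nat_le_iff, simp)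
    also have "\<dots> = 2 * D * (1 / real q) ^ N n"
      using q by (simp add: n power_add field_simps)
    finally show ?thesis .
  qed
  then show "\<forall>\<^sub>F n in L. (\<Sum>x\<in>?B n. F n x) \<le> 2 * D * (1 / real q) ^ N n"
    by simp
  have "(\<lambda>k. (1 / real q) ^ k) \<longlonglongrightarrow> 0"
    using q by (intro LIMSEQ_power_zero) simp
  from tendsto_mult_right_zero[OF filterlim_compose[OF this N]]
  show "((\<lambda>n. 2 * D * (1 / real q) ^ N n) \<longlongrightarrow> 0) L" .
qed simp

end

section \<open>Concentration of the energy\<close>

theorem theorem4p10:
  fixes adj :: "'v \<Rightarrow> 'v \<Rightarrow> bool" and q :: nat and org :: 'v
    and u :: "'v \<Rightarrow> int \<Rightarrow> complex" and f g :: "'v \<Rightarrow> complex" and N :: "int \<Rightarrow> nat"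
  assumes tree: "homogeneous_tree adj q" and q: "q \<ge> 2"
    and wave: "\<And>x n. of_real (gamma_const q) * laplacian_int (\<lambda>m. u x m) n =
                  laplacian_tree adj q (\<lambda>y. u y n) x - u x n + of_real (gamma_const q) * u x n"
    and init_f: "\<And>x. u x 0 = f x"
    and init_g: "\<And>x. (u x 1 - u x (- 1)) / 2 = g x"
    and fin_f: "finite {x. f x \<noteq> 0}" and fin_g: "finite {x. g x \<noteq> 0}"
    and N_pos: "\<And>n. N n > 0"
    and N_lim: "filterlim N at_top at_pm_infinity"
    and N_small: "(\<lambda>n. real (N n)) \<in> o[at_pm_infinity](\<lambda>n. real_of_int \<bar>n\<bar>)"
  shows "((\<lambda>n. \<Sum>x\<in>{x. int (graph_dist adj org x) < \<bar>n\<bar> - int (N n)}. (cmod (u x n))\<^sup>2)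
            \<longlongrightarrow> 0) at_pm_infinity
       \<and> ((\<lambda>n. \<Sum>(x, y)\<in>{(x, y). int (graph_dist adj org x) < \<bar>n\<bar> - int (N n) \<and>
                               int (graph_dist adj org y) < \<bar>n\<bar> - int (N n) \<and>
                               graph_dist adj x y = 2}. (cmod (u x n - u y n))\<^sup>2)
            \<longlongrightarrow> 0) at_pm_infinity
       \<and> ((\<lambda>n. \<Sum>x\<in>{x. int (graph_dist adj org x) < \<bar>n\<bar> - int (N n)}.
                  (cmod (u x (n + 1) - u x (n - 1)))\<^sup>2)
            \<longlongrightarrow> 0) at_pm_infinity"
proof -
  interpret homogeneous_tree adj q by (rule tree)
  have q1: "q \<ge> 1" using q by simp
  define s where "s = 1 / sqrt (real q)"
  have s: "0 < s" "s \<le> 1" using q1 by (simp_all add: s_def)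
  have s_sq: "(s ^ k)\<^sup>2 = (1 / real q) ^ k" for k
  proof -
    have "(s ^ k)\<^sup>2 = (s\<^sup>2) ^ k" by (simp flip: power_mult add: mult.commute)
    also have "s\<^sup>2 = 1 / real q" by (simp add: s_def power_divide)
    finally show ?thesis .
  qed
  have "{x. u x 1 \<noteq> u x (- 1)} = {x. g x \<noteq> 0}" by (auto simp flip: init_g)
  then have "finite {x. u x 1 \<noteq> u x (- 1)}" using fin_g by simp
  moreover have "finite {x. u x 0 \<noteq> 0}" using fin_f by (simp add: init_f)
  ultimately obtain C where C: "C \<ge> 0" "\<And>n x. cmod (u x n) \<le> C * s ^ nat \<bar>n\<bar>"
    using two_sided_wave_decay[OF q1 wave_equation_imp_recursion[OF q1 wave]]
    unfolding s_def by metis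
  have sq_le: "(cmod (a - b))\<^sup>2 \<le> (2 * K)\<^sup>2 * (1 / real q) ^ m"
    if "cmod a \<le> K * s ^ m" "cmod b \<le> K * s ^ m" for a b K m
  proof -
    have "cmod (a - b) \<le> 2 * K * s ^ m"
      using norm_triangle_ineq4[of a b] that by simp
    then have "(cmod (a - b))\<^sup>2 \<le> (2 * K * s ^ m)\<^sup>2"
      by (rule power_mono) simp
    then show ?thesis by (simp only: power_mult_distrib[of "2 * K"] s_sq)
  qed
  \<comment> \<open>A shift in time by one costs at most a factor \<open>1 / s\<close>.\<close>
  have shift: "cmod (u x k) \<le> C / s * s ^ nat \<bar>n\<bar>" if "nat \<bar>n\<bar> \<le> Suc (nat \<bar>k\<bar>)" for x k n
  proof -
    have "s ^ Suc (nat \<bar>k\<bar>) \<le> s ^ nat \<bar>n\<bar>"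
      using that s by (intro power_decreasing) auto
    then have "C / s * s ^ Suc (nat \<bar>k\<bar>) \<le> C / s * s ^ nat \<bar>n\<bar>"
      using C(1) s by (intro mult_left_mono) auto
    moreover have "C / s * s ^ Suc (nat \<bar>k\<bar>) = C * s ^ nat \<bar>k\<bar>" using s by simp
    ultimately show ?thesis using C(2)[of x k] by linarith
  qed
  let ?B = "\<lambda>n. {x. int (gdist org x) < \<bar>n\<bar> - int (N n)}"
  have first: "((\<lambda>n. \<Sum>x\<in>?B n. (cmod (u x n))\<^sup>2) \<longlongrightarrow> 0) at_pm_infinity"
  proof (rule sum_inner_ball_tendsto_0[OF q N_lim])
    show "(cmod (u x n))\<^sup>2 \<le> C\<^sup>2 * (1 / real q) ^ nat \<bar>n\<bar>" for n x
      using power_mono[OF C(2)[of x n], of 2] by (simp only: power_mult_distrib s_sq) simp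
  qed simp
  have third: "((\<lambda>n. \<Sum>x\<in>?B n. (cmod (u x (n + 1) - u x (n - 1)))\<^sup>2) \<longlongrightarrow> 0) at_pm_infinity"
  proof (rule sum_inner_ball_tendsto_0[OF q N_lim])
    show "(cmod (u x (n + 1) - u x (n - 1)))\<^sup>2 \<le> (2 * (C / s))\<^sup>2 * (1 / real q) ^ nat \<bar>n\<bar>" for n x
      by (intro sq_le shift) auto
  qed simp
  let ?F = "\<lambda>n x. \<Sum>y\<in>graph_sphere adj x 2. (cmod (u x n - u y n))\<^sup>2"
  let ?P = "\<lambda>n. {(x, y). int (gdist org x) < \<bar>n\<bar> - int (N n) \<and>
                         int (gdist org y) < \<bar>n\<bar> - int (N n) \<and> gdist x y = 2}"
  have "((\<lambda>n. \<Sum>x\<in>?B n. ?F n x) \<longlongrightarrow> 0) at_pm_infinity"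
  proof (rule sum_inner_ball_tendsto_0[OF q N_lim])
    fix n x
    have "?F n x \<le> real (card (graph_sphere adj x 2)) * ((2 * C)\<^sup>2 * (1 / real q) ^ nat \<bar>n\<bar>)"
      by (intro sum_bounded_above sq_le C(2))
    also have "\<dots> \<le> real (2 * q ^ 2) * ((2 * C)\<^sup>2 * (1 / real q) ^ nat \<bar>n\<bar>)"
      using card_sphere_le[OF q1, of x 2] by (intro mult_right_mono) (simp_all only: of_nat_le_iff, simp)
    finally show "?F n x \<le> real (2 * q ^ 2) * (2 * C)\<^sup>2 * (1 / real q) ^ nat \<bar>n\<bar>"
      by (simp only: mult.assoc)
  qed (simp add: sum_nonneg)
  \<comment> \<open>Enlarge the set of pairs by dropping the condition on \<open>|y|\<close>.\<close>
  then have second: "((\<lambda>n. \<Sum>(x, y)\<in>?P n. (cmod (u x n - u y n))\<^sup>2) \<longlongrightarrow> 0) at_pm_infinity"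
  proof (rule tendsto_sandwich[OF _ _ tendsto_const, rotated 2])
    have "(\<Sum>(x, y)\<in>?P n. (cmod (u x n - u y n))\<^sup>2) \<le> (\<Sum>x\<in>?B n. ?F n x)" for n
    proof -
      have "(\<Sum>(x, y)\<in>?P n. (cmod (u x n - u y n))\<^sup>2)
              \<le> (\<Sum>(x, y)\<in>Sigma (?B n) (\<lambda>x. graph_sphere adj x 2). (cmod (u x n - u y n))\<^sup>2)"
        by (rule sum_mono2[OF finite_SigmaI[OF finite_ball finite_sphere]])
           (auto simp: graph_sphere_def)
      also have "\<dots> = (\<Sum>x\<in>?B n. ?F n x)"
        by (rule sum.Sigma[symmetric]) (auto simp: finite_ball finite_sphere)
      finally show ?thesis .
    qed
    then show "\<forall>\<^sub>F n in at_pm_infinity.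
        (\<Sum>(x, y)\<in>?P n. (cmod (u x n - u y n))\<^sup>2) \<le> (\<Sum>x\<in>?B n. ?F n x)"
      by simp
  qed (auto intro!: always_eventually sum_nonneg)
  from first second third show ?thesis by blast
qed

end
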